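(* Let $G=(V,E)$ be a finite simple connected graph with an edge $e=uv$. Then $\beth^{2}(G/e)\le \beth^{2}(G)$.
   Context: All graphs are finite and simple. For an edge $e=uv$, $G/e$ is the simple graph obtained by contracting $e$: the vertices $u,v$ are replaced by a single vertex $v_e$ adjacent to exactly those other vertices that are adjacent to $u$ or $v$ in $G$ (no loops or multiple edges are created). $C(G)$ denotes the set of all induced cycles in $G$ (of length at least 3). The second graph characteristic is $\beth^{2}(G)=|C(G)|-|E(G)|+|V(G)|$. *)

theory Defs
  imports Main
begin

datatype 'a ugraph = UGraph (verts: "'a set") (edges: "'a set set")

definition finite_simple_graph :: "'a ugraph \<Rightarrow> bool" where
  "finite_simple_graph G \<longleftrightarrow>
     finite (verts G) \<and> (\<forall>f\<in>edges G. f \<subseteq> verts G \<and> card f = 2)"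

definition connected_graph :: "'a ugraph \<Rightarrow> bool" where
  "connected_graph G \<longleftrightarrow> verts G \<noteq> {} \<and>
     (\<forall>x\<in>verts G. \<forall>y\<in>verts G. (x, y) \<in> {(a, b). {a, b} \<in> edges G}\<^sup>*)"

text \<open>
  The contraction lives on the option type, so that the new vertex \<open>None\<close> is fresh
  by construction; the vertices outside the contracted edge are kept as \<open>Some x\<close>.
  The edges form a set, hence two edges that become parallel are identified, and the
  contracted edge itself disappears.
\<close>

definition contract :: "'a ugraph \<Rightarrow> 'a set \<Rightarrow> 'a option ugraph" where
  "contract G e = UGraph
     (insert None (Some ` (verts G - e)))
     ({{Some x, Some y} | x y. {x, y} \<in> edges G \<and> x \<notin> e \<and> y \<notin> e} \<union>
      {{None, Some x} | x. x \<in> verts G - e \<and> (\<exists>y\<in>e. {x, y} \<in> edges G)})"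

definition induced_subgraph :: "'a ugraph \<Rightarrow> 'a set \<Rightarrow> 'a ugraph" where
  "induced_subgraph G W = UGraph W {f \<in> edges G. f \<subseteq> W}"

definition is_cycle :: "'a ugraph \<Rightarrow> bool" where
  "is_cycle H \<longleftrightarrow> (\<exists>xs. distinct xs \<and> length xs \<ge> 3 \<and> verts H = set xs \<and>
     edges H = {{xs ! i, xs ! (Suc i mod length xs)} | i. i < length xs})"

text \<open>Cycles are counted as subgraphs, so rotations and reflections of one vertex list
  give the same cycle.\<close>

definition induced_cycles :: "'a ugraph \<Rightarrow> 'a ugraph set" where
  "induced_cycles G =
     {H. (\<exists>W \<subseteq> verts G. H = induced_subgraph G W) \<and> is_cycle H}"

definition beth2 :: "'a ugraph \<Rightarrow> int" where
  "beth2 G = int (card (induced_cycles G)) - int (card (edges G)) + int (card (verts G))"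

lemma finite_edges: "finite (edges G)" if "finite_simple_graph G"
proof (rule finite_subset)
  show "edges G \<subseteq> Pow (verts G)" using that by (auto simp: finite_simple_graph_def)
  show "finite (Pow (verts G))" using that by (simp add: finite_simple_graph_def)
qed

lemma finite_induced_cycles: "finite (induced_cycles G)" if "finite_simple_graph G"
proof (rule finite_subset)
  show "induced_cycles G \<subseteq> induced_subgraph G ` Pow (verts G)"
    by (auto simp: induced_cycles_def)
  show "finite (induced_subgraph G ` Pow (verts G))"
    using that by (simp add: finite_simple_graph_def)
qed

lemma finite_simple_graph_contract:
  "finite_simple_graph (contract G e)" if "finite_simple_graph G"
proof -
  have "x \<in> verts G \<and> y \<in> verts G \<and> x \<noteq> y" if "{x, y} \<in> edges G" for x y
    using \<open>finite_simple_graph G\<close> that unfolding finite_simple_graph_def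
    by (cases "x = y") fastforce+
  then show ?thesis
    using that by (fastforce simp: finite_simple_graph_def contract_def)
qed

end

theory Submission
  imports Defs
begin

text \<open>
  Contracting \<open>e = uv\<close> removes one vertex and \<open>1 + t\<close> edges, where \<open>t\<close> is the number of common
  neighbours of \<open>u\<close> and \<open>v\<close>. Hence it suffices to inject the induced cycles of \<open>G/e\<close> into the
  induced cycles of \<open>G\<close> other than the \<open>t\<close> triangles through \<open>e\<close>. An induced cycle avoiding the
  new vertex is kept. In an induced cycle through it, the new vertex has exactly two neighbours;
  if both are adjacent to \<open>u\<close> (or both to \<open>v\<close>), replace the new vertex by \<open>u\<close> (or \<open>v\<close>);
  otherwise, replace it by the edge \<open>uv\<close>, which gives a cycle of length at least 4. The original
  cycle is recovered by deleting \<open>u\<close> and \<open>v\<close>.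
\<close>

section \<open>Cycles as vertex lists\<close>

text \<open>The edge set of an open path, with no closing edge; a cycle with one vertex deleted
  leaves such a path.\<close>

fun path_edges :: "'a list \<Rightarrow> 'a set set" where
  "path_edges (x # y # zs) = insert {x, y} (path_edges (y # zs))"
| "path_edges _ = {}"

text \<open>The right-hand side is the edge set from \<open>is_cycle\<close>, so that the vertex
  list of a cycle can be manipulated on its own.\<close>

definition cycle_edges :: "'a list \<Rightarrow> 'a set set" where
  "cycle_edges xs = {{xs ! i, xs ! (Suc i mod length xs)} | i. i < length xs}"

lemma path_edges_conv_nth:
  "path_edges xs = {{xs ! i, xs ! Suc i} | i. Suc i < length xs}"
proof (induction xs rule: path_edges.induct)
  case (1 x y zs)
  have "{{(x # y # zs) ! i, (x # y # zs) ! Suc i} | i. Suc i < length (x # y # zs)} =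
      insert {x, y} {{(y # zs) ! i, (y # zs) ! Suc i} | i. Suc i < length (y # zs)}"
    (is "?L = ?R")
  proof
    show "?L \<subseteq> ?R"
    proof
      fix f assume "f \<in> ?L"
      then obtain i where "f = {(x # y # zs) ! i, (x # y # zs) ! Suc i}"
        "Suc i < length (x # y # zs)" by blast
      then show "f \<in> ?R" by (cases i) auto
    qed
    show "?R \<subseteq> ?L"
    proof
      fix f assume "f \<in> ?R"
      then consider "f = {x, y}" | i where "f = {(y # zs) ! i, (y # zs) ! Suc i}" "Suc i < length (y # zs)"
        by blast
      then show "f \<in> ?L"
      proof cases
        case 1
        then show ?thesis by (intro CollectI exI[of _ 0]) simp
      next
        case (2 i)
        then show ?thesis by (intro CollectI exI[of _ "Suc i"]) simp
      qed
    qed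
  qed
  with 1 show ?case by simp
qed auto

lemma path_edges_map: "path_edges (map f xs) = (`) f ` path_edges xs"
  by (induction xs rule: path_edges.induct) auto

lemma cycle_edges_map: "cycle_edges (map f xs) = (`) f ` cycle_edges xs"
proof -
  have "cycle_edges (map f xs) =
      (\<lambda>i. {map f xs ! i, map f xs ! (Suc i mod length xs)}) ` {..<length xs}"
    unfolding cycle_edges_def by (simp only: setcompr_eq_image lessThan_def length_map)
  also have "\<dots> = (\<lambda>i. f ` {xs ! i, xs ! (Suc i mod length xs)}) ` {..<length xs}"
  proof (intro image_cong refl)
    fix i assume i: "i \<in> {..<length xs}"
    \<comment> \<open>The wrapped successor index stays in range, which the evaluation of
      \<open>map f xs\<close> at that index requires.\<close>
    then have "Suc i mod length xs < length xs" by (intro mod_less_divisor) auto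
    with i show "{map f xs ! i, map f xs ! (Suc i mod length xs)} = f ` {xs ! i, xs ! (Suc i mod length xs)}"
      by simp
  qed
  also have "\<dots> = (`) f ` cycle_edges xs"
    unfolding cycle_edges_def by (simp only: setcompr_eq_image image_image lessThan_def)
  finally show ?thesis .
qed

lemma path_edges_snoc:
  "xs \<noteq> [] \<Longrightarrow> path_edges (xs @ [y]) = insert {last xs, y} (path_edges xs)"
  by (induction xs rule: path_edges.induct) auto

lemma path_edges_subset: "f \<in> path_edges xs \<Longrightarrow> f \<subseteq> set xs"
  by (induction xs rule: path_edges.induct) auto

lemma cycle_edges_conv_path_edges:
  assumes "xs \<noteq> []"
  shows "cycle_edges xs = insert {last xs, hd xs} (path_edges xs)"
proof -
  obtain n where n: "length xs = Suc n"
    using assms by (cases xs) auto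
  \<comment> \<open>Index \<open>n\<close> is the last one: its successor wraps to 0 and yields the
    closing edge. Below \<open>n\<close> the modulus has no effect.\<close>
  have "cycle_edges xs =
      insert {xs ! n, xs ! 0} {{xs ! i, xs ! (Suc i mod Suc n)} | i. i < n}"
    unfolding cycle_edges_def n by (auto simp: less_Suc_eq)
  also have "{{xs ! i, xs ! (Suc i mod Suc n)} | i. i < n} = {{xs ! i, xs ! Suc i} | i. i < n}"
    by (metis (no_types, opaque_lifting) Suc_less_eq mod_less)
  finally show ?thesis
    using assms n by (simp add: path_edges_conv_nth last_conv_nth hd_conv_nth)
qed

text \<open>Rotation only exchanges roles: the closing edge becomes a path edge, and the first path
  edge becomes the closing one.\<close>

lemma cycle_edges_rotate1: "cycle_edges (rotate1 xs) = cycle_edges xs"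
proof (cases xs)
  case (Cons x ys)
  show ?thesis
  proof (cases ys)
    case (Cons y zs)
    then show ?thesis
      using \<open>xs = x # ys\<close> path_edges_snoc[of "y # zs" x]
      by (simp add: cycle_edges_conv_path_edges insert_commute)
  qed (simp add: Cons)
qed simp

lemma cycle_edges_rotate: "cycle_edges (rotate n xs) = cycle_edges xs"
  by (induction n) (simp_all add: cycle_edges_rotate1)

lemma is_cycle_alt:
  "is_cycle H \<longleftrightarrow> (\<exists>xs. distinct xs \<and> length xs \<ge> 3 \<and> verts H = set xs \<and> edges H = cycle_edges xs)"
  by (simp add: is_cycle_def cycle_edges_def)

text \<open>A cycle has no distinguished start, so its vertex list can be rotated until
  \<open>x\<close> comes first.\<close>

lemma is_cycle_through:
  assumes "is_cycle H" "x \<in> verts H"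
  obtains ws where "distinct (x # ws)" "length ws \<ge> 2" "verts H = insert x (set ws)"
    "edges H = cycle_edges (x # ws)"
proof -
  obtain xs where xs: "distinct xs" "length xs \<ge> 3" "verts H = set xs" "edges H = cycle_edges xs"
    using assms(1) by (auto simp: is_cycle_alt)
  obtain ys zs where "xs = ys @ x # zs"
    using assms(2) xs(3) by (metis split_list)
  then have "rotate (length ys) xs = x # zs @ ys"
    by (simp add: rotate_append)
  with xs that[of "zs @ ys"] show thesis
    by (metis (no_types, lifting) One_nat_def Suc_le_mono cycle_edges_rotate distinct_rotate
        length_Cons length_rotate list.simps(15) numeral_2_eq_2 numeral_3_eq_3 set_rotate)
qed

section \<open>Induced cycles as vertex sets\<close>

definition nbrs :: "'a ugraph \<Rightarrow> 'a \<Rightarrow> 'a set" where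
  "nbrs G x = {w. {x, w} \<in> edges G}"

text \<open>Induced cycles are represented by their vertex sets, which determine them; cycles of a
  graph and of its contraction can then be related by plain set operations.\<close>

definition cycle_sets :: "'a ugraph \<Rightarrow> 'a set set" where
  "cycle_sets G = {W. W \<subseteq> verts G \<and> is_cycle (induced_subgraph G W)}"

lemma card_induced_cycles: "card (induced_cycles G) = card (cycle_sets G)"
proof -
  have "induced_cycles G = induced_subgraph G ` cycle_sets G"
    by (auto simp: induced_cycles_def cycle_sets_def)
  moreover have "inj_on (induced_subgraph G) (cycle_sets G)"
    by (auto simp: inj_on_def induced_subgraph_def)
  ultimately show ?thesis by (simp add: card_image)
qed

lemma finite_cycle_sets: "finite_simple_graph G \<Longrightarrow> finite (cycle_sets G)"
  unfolding cycle_sets_def finite_simple_graph_def by auto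

lemma edgeD:
  assumes "finite_simple_graph G" "{x, y} \<in> edges G"
  shows "x \<in> verts G" "y \<in> verts G" "x \<noteq> y"
proof -
  have "{x, y} \<subseteq> verts G" "card {x, y} = 2"
    using assms by (auto simp: finite_simple_graph_def)
  then show "x \<in> verts G" "y \<in> verts G" "x \<noteq> y" by auto
qed

lemma edgeE:
  assumes "finite_simple_graph G" "f \<in> edges G"
  obtains x y where "f = {x, y}" "x \<noteq> y"
  using assms by (metis card_2_iff finite_simple_graph_def)

lemma edges_within_insert:
  assumes "finite_simple_graph G"
  shows "{f \<in> edges G. f \<subseteq> insert x S} =
    {f \<in> edges G. f \<subseteq> S} \<union> (\<lambda>w. {x, w}) ` (nbrs G x \<inter> S)"
proof (intro equalityI subsetI)
  fix f assume f: "f \<in> {f \<in> edges G. f \<subseteq> insert x S}"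
  then obtain a b where "f = {a, b}" "a \<noteq> b"
    using edgeE[OF assms] by blast
  with f show "f \<in> {f \<in> edges G. f \<subseteq> S} \<union> (\<lambda>w. {x, w}) ` (nbrs G x \<inter> S)"
    by (auto simp: nbrs_def insert_commute)
qed (auto simp: nbrs_def)

text \<open>Both edge sets split into the edges avoiding \<open>x\<close> and the edges at
  \<open>x\<close>, and the parts are compared separately. This is the working criterion for induced
  cycles: deleting \<open>x\<close> leaves an induced path whose ends are exactly the neighbours of
  \<open>x\<close> on it. In this form one vertex can be exchanged for another over the same
  path.\<close>

lemma edges_within_insert_eq_cycle_edges_iff:
  assumes "finite_simple_graph G" "x \<notin> set ws" "ws \<noteq> []"
  shows "{f \<in> edges G. f \<subseteq> insert x (set ws)} = cycle_edges (x # ws) \<longleftrightarrow>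
    {f \<in> edges G. f \<subseteq> set ws} = path_edges ws \<and> nbrs G x \<inter> set ws = {hd ws, last ws}"
    (is "?L \<longleftrightarrow> ?R")
proof -
  let ?p = "\<lambda>w. {x, w}"
  have "path_edges (x # ws) = insert {x, hd ws} (path_edges ws)"
    using assms(3) by (cases ws) auto
  then have c: "cycle_edges (x # ws) = path_edges ws \<union> ?p ` {hd ws, last ws}"
    using assms(3) by (auto simp: cycle_edges_conv_path_edges insert_commute)
  have inj: "inj ?p" by (auto simp: inj_on_def doubleton_eq_iff)
  have sep: "A \<union> B = C \<union> D \<longleftrightarrow> A = C \<and> B = D"
    if "\<And>f. f \<in> A \<union> C \<Longrightarrow> x \<notin> f" "\<And>f. f \<in> B \<union> D \<Longrightarrow> x \<in> f" for A B C D :: "'a set set"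
  proof -
    have "A = {f \<in> A \<union> B. x \<notin> f}" "B = {f \<in> A \<union> B. x \<in> f}"
      "C = {f \<in> C \<union> D. x \<notin> f}" "D = {f \<in> C \<union> D. x \<in> f}"
      using that by auto
    then show ?thesis by metis
  qed
  have "?L \<longleftrightarrow> {f \<in> edges G. f \<subseteq> set ws} \<union> ?p ` (nbrs G x \<inter> set ws) =
      path_edges ws \<union> ?p ` {hd ws, last ws}"
    unfolding edges_within_insert[OF assms(1)] c ..
  also have "\<dots> \<longleftrightarrow> {f \<in> edges G. f \<subseteq> set ws} = path_edges ws \<and>
      ?p ` (nbrs G x \<inter> set ws) = ?p ` {hd ws, last ws}" (is "?A \<union> ?B = ?C \<union> ?D \<longleftrightarrow> _")
  proof (rule sep)
    show "x \<notin> f" if "f \<in> ?A \<union> ?C" for f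
      using that path_edges_subset[of f ws] assms(2) by auto
    show "x \<in> f" if "f \<in> ?B \<union> ?D" for f
      using that by auto
  qed
  also have "\<dots> \<longleftrightarrow> ?R" using inj by (simp only: inj_image_eq_iff)
  finally show ?thesis .
qed

lemma cycle_setsI:
  assumes "finite_simple_graph G" "distinct (x # ws)" "length ws \<ge> 2" "insert x (set ws) \<subseteq> verts G"
    and "{f \<in> edges G. f \<subseteq> set ws} = path_edges ws" "nbrs G x \<inter> set ws = {hd ws, last ws}"
  shows "insert x (set ws) \<in> cycle_sets G"
proof -
  have "{f \<in> edges G. f \<subseteq> insert x (set ws)} = cycle_edges (x # ws)"
    using assms by (subst edges_within_insert_eq_cycle_edges_iff) auto
  then have "is_cycle (induced_subgraph G (insert x (set ws)))"
    unfolding is_cycle_alt induced_subgraph_def using assms(2,3)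
    by (intro exI[of _ "x # ws"]) auto
  with assms(4) show ?thesis by (simp add: cycle_sets_def)
qed

lemma cycle_setsE:
  assumes "finite_simple_graph G" "W \<in> cycle_sets G" "x \<in> W"
  obtains ws where "distinct (x # ws)" "length ws \<ge> 2" "W = insert x (set ws)"
    "{f \<in> edges G. f \<subseteq> set ws} = path_edges ws" "nbrs G x \<inter> set ws = {hd ws, last ws}"
proof -
  have "is_cycle (induced_subgraph G W)" "x \<in> verts (induced_subgraph G W)"
    using assms(2,3) by (auto simp: cycle_sets_def induced_subgraph_def)
  then obtain ws where ws: "distinct (x # ws)" "length ws \<ge> 2"
    "verts (induced_subgraph G W) = insert x (set ws)"
    "edges (induced_subgraph G W) = cycle_edges (x # ws)"
    by (rule is_cycle_through)
  then have W: "W = insert x (set ws)" "{f \<in> edges G. f \<subseteq> W} = cycle_edges (x # ws)"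
    by (auto simp: induced_subgraph_def)
  have "x \<notin> set ws" "ws \<noteq> []" using ws(1,2) by auto
  note iff = edges_within_insert_eq_cycle_edges_iff[OF assms(1) this]
  show thesis
    using that[of ws] ws(1,2) W iff by simp
qed

text \<open>The vertex \<open>w\<close> closes the path \<open>[u, v]\<close>, whose only induced
  edge is \<open>{u, v}\<close>. These triangles are the cycles of \<open>G\<close> set aside in the
  count.\<close>

lemma triangle_in_cycle_sets:
  assumes "finite_simple_graph G" "{u, v} \<in> edges G" "{w, u} \<in> edges G" "{w, v} \<in> edges G"
  shows "{u, v, w} \<in> cycle_sets G"
proof -
  have "u \<noteq> v" "w \<noteq> u" "w \<noteq> v" and V: "{u, v, w} \<subseteq> verts G"
    using edgeD[OF assms(1,2)] edgeD[OF assms(1,3)] edgeD[OF assms(1,4)] by auto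
  have "f = {u, v}" if f: "f \<in> edges G" "f \<subseteq> {u, v}" for f
  proof -
    obtain a b where "f = {a, b}" "a \<noteq> b"
      using edgeE[OF assms(1) f(1)] .
    with f(2) show ?thesis by auto
  qed
  then have "{f \<in> edges G. f \<subseteq> set [u, v]} = path_edges [u, v]"
    using assms(2) by auto
  moreover have "nbrs G w \<inter> set [u, v] = {hd [u, v], last [u, v]}"
    using assms(3,4) by (auto simp: nbrs_def)
  ultimately have "insert w (set [u, v]) \<in> cycle_sets G"
    using \<open>u \<noteq> v\<close> \<open>w \<noteq> u\<close> \<open>w \<noteq> v\<close> V by (intro cycle_setsI assms(1)) auto
  then show ?thesis by (simp add: insert_commute)
qed

section \<open>Contraction\<close>

text \<open>Pulls a vertex list that avoids the new vertex \<open>None\<close> back to the vertices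
  of \<open>G\<close>, since \<open>the\<close> undoes \<open>Some\<close> on each entry.\<close>

lemma list_in_Some_image:
  assumes "set ys = Some ` S"
  shows "\<exists>xs. ys = map Some xs"
proof
  show "ys = map Some (map the ys)"
    unfolding map_map using assms by (intro map_idI[symmetric]) auto
qed

lemma inj_image_Some: "inj ((`) Some)"
  by (simp add: inj_def inj_image_eq_iff)

text \<open>Contraction changes nothing away from \<open>e\<close>, so conditions on edges there
  transfer between the two graphs.\<close>

lemma edges_contract_within_Some:
  assumes "finite_simple_graph G" "S \<inter> e = {}"
  shows "{f \<in> edges (contract G e). f \<subseteq> Some ` S} = (`) Some ` {f \<in> edges G. f \<subseteq> S}"
proof (intro equalityI subsetI)
  fix f assume "f \<in> {f \<in> edges (contract G e). f \<subseteq> Some ` S}"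
  then obtain x y where "f = Some ` {x, y}" "{x, y} \<in> edges G" "{x, y} \<subseteq> S"
    by (auto simp: contract_def)
  then show "f \<in> (`) Some ` {f \<in> edges G. f \<subseteq> S}" by blast
next
  fix f assume "f \<in> (`) Some ` {f \<in> edges G. f \<subseteq> S}"
  then obtain h where h: "f = Some ` h" "h \<in> edges G" "h \<subseteq> S" by blast
  obtain x y where "h = {x, y}" using edgeE[OF assms(1) h(2)] by blast
  then show "f \<in> {f \<in> edges (contract G e). f \<subseteq> Some ` S}"
    using h assms(2) by (auto simp: contract_def)
qed

lemma nbrs_contract_None:
  assumes "finite_simple_graph G"
  shows "nbrs (contract G {u, v}) None = Some ` (nbrs G u \<union> nbrs G v - {u, v})"
  using edgeD[OF assms]
  by (auto simp: nbrs_def contract_def doubleton_eq_iff insert_commute)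

section \<open>Lifting induced cycles from the contraction to \<open>G\<close>\<close>

lemma subset_verts_contractD:
  "Some ` S \<subseteq> verts (contract G e) \<Longrightarrow> S \<subseteq> verts G - e"
  by (auto simp: contract_def)

lemma cycle_sets_contract_avoiding:
  assumes "finite_simple_graph G" "S \<inter> e = {}" "Some ` S \<in> cycle_sets (contract G e)"
  shows "S \<in> cycle_sets G"
proof -
  have S: "S \<subseteq> verts G"
    using assms(3) subset_verts_contractD[of S G e] by (auto simp: cycle_sets_def)
  obtain ws where ws: "distinct ws" "length ws \<ge> 3" "Some ` S = set ws"
    "{f \<in> edges (contract G e). f \<subseteq> Some ` S} = cycle_edges ws"
    using assms(3) unfolding cycle_sets_def is_cycle_alt induced_subgraph_def mem_Collect_eq
      ugraph.sel by blast
  obtain xs where xs: "ws = map Some xs"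
    using list_in_Some_image[OF ws(3)[symmetric]] ..
  have "(`) Some ` {f \<in> edges G. f \<subseteq> S} = (`) Some ` cycle_edges xs"
    using ws(4) edges_contract_within_Some[OF assms(1,2)] by (simp add: xs cycle_edges_map)
  then have "{f \<in> edges G. f \<subseteq> S} = cycle_edges xs"
    by (simp only: inj_image_eq_iff inj_image_Some)
  moreover have "S = set xs"
    using ws(3) by (simp add: xs inj_image_eq_iff)
  moreover have "distinct xs" "length xs \<ge> 3"
    using ws(1,2) by (simp_all add: xs distinct_map)
  ultimately have "is_cycle (induced_subgraph G S)"
    unfolding is_cycle_alt induced_subgraph_def by (intro exI[of _ xs]) simp
  with S show ?thesis by (simp add: cycle_sets_def)
qed

text \<open>Opens the contracted vertex up into an edge: \<open>v\<close> prolongs the path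
  \<open>ws\<close> beyond its last vertex, and \<open>u\<close>, adjacent to \<open>hd ws\<close>
  and to \<open>v\<close>, closes the longer path to a cycle.\<close>

lemma cycle_sets_split:
  assumes G: "finite_simple_graph G" and uv: "{u, v} \<in> edges G"
    and ws: "distinct ws" "length ws \<ge> 2" "set ws \<subseteq> verts G" "u \<notin> set ws" "v \<notin> set ws"
    and path: "{f \<in> edges G. f \<subseteq> set ws} = path_edges ws"
    and Nu: "nbrs G u \<inter> set ws = {hd ws}" and Nv: "nbrs G v \<inter> set ws = {last ws}"
  shows "insert u (insert v (set ws)) \<in> cycle_sets G"
proof -
  have "ws \<noteq> []" using ws(2) by auto
  have "insert u (set (ws @ [v])) \<in> cycle_sets G"
  proof (rule cycle_setsI[OF G])
    show "{f \<in> edges G. f \<subseteq> set (ws @ [v])} = path_edges (ws @ [v])"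
      using path Nv edges_within_insert[OF G, of v "set ws"] \<open>ws \<noteq> []\<close>
      by (auto simp: path_edges_snoc insert_commute)
    show "nbrs G u \<inter> set (ws @ [v]) = {hd (ws @ [v]), last (ws @ [v])}"
      using Nu uv \<open>ws \<noteq> []\<close> by (auto simp: nbrs_def)
  qed (use ws edgeD[OF G uv] in auto)
  then show ?thesis by (simp add: insert_commute)
qed

text \<open>If neither set contains both elements, each contains exactly one. This is the case
  distinction for how the two cycle neighbours of \<open>None\<close> are shared between
  \<open>u\<close> and \<open>v\<close>.\<close>

lemma Un_eq_doubleton:
  assumes "A \<union> B = {a, b}"
  shows "A = {a, b} \<or> B = {a, b} \<or> A = {a} \<and> B = {b} \<or> A = {b} \<and> B = {a}"
proof -
  have sub: "A \<subseteq> {a, b}" "B \<subseteq> {a, b}" and cover: "a \<in> A \<or> a \<in> B" "b \<in> A \<or> b \<in> B"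
    using assms by auto
  then consider "a \<in> A" "b \<in> A" | "a \<in> B" "b \<in> B"
    | "a \<in> A" "b \<notin> A" "a \<notin> B" "b \<in> B" | "a \<notin> A" "b \<in> A" "a \<in> B" "b \<notin> B"
    by argo
  then show ?thesis
  proof cases
    case 1
    with sub(1) have "A = {a, b}" by auto
    then show ?thesis ..
  next
    case 2
    with sub(2) have "B = {a, b}" by auto
    then show ?thesis by simp
  next
    case 3
    with sub have "A = {a}" "B = {b}" by auto
    then show ?thesis by simp
  next
    case 4
    with sub have "A = {b}" "B = {a}" by auto
    then show ?thesis by simp
  qed
qed

text \<open>Deleting \<open>None\<close> leaves a path that is also induced in \<open>G\<close>, and
  each of its ends is adjacent to \<open>u\<close> or \<open>v\<close>. The bound on
  \<open>card S\<close> later keeps the lifted cycle apart from the triangles through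
  \<open>uv\<close>.\<close>

lemma cycle_sets_contract_through:
  assumes G: "finite_simple_graph G" and uv: "{u, v} \<in> edges G"
    and S: "S \<inter> {u, v} = {}" "insert None (Some ` S) \<in> cycle_sets (contract G {u, v})"
  shows "card S \<ge> 2"
    and "insert u S \<in> cycle_sets G \<or> insert v S \<in> cycle_sets G \<or>
      insert u (insert v S) \<in> cycle_sets G"
proof -
  let ?H = "contract G {u, v}"
  have H: "finite_simple_graph ?H"
    using G by (rule finite_simple_graph_contract)
  obtain ys where ys: "distinct (None # ys)" "length ys \<ge> 2"
    "insert None (Some ` S) = insert None (set ys)"
    "{f \<in> edges ?H. f \<subseteq> set ys} = path_edges ys" "nbrs ?H None \<inter> set ys = {hd ys, last ys}"
    using cycle_setsE[OF H S(2)] by blast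
  have "set ys = Some ` S" using ys(1,3) insert_ident[of None "Some ` S" "set ys"] by auto
  then obtain ws where ws: "ys = map Some ws" using list_in_Some_image[of ys S] by auto
  with \<open>set ys = Some ` S\<close> have S_eq: "S = set ws" by (simp add: inj_image_eq_iff)
  have d: "distinct ws" "length ws \<ge> 2" "ws \<noteq> []"
    using ys(1,2) by (auto simp: ws distinct_map)
  then show "card S \<ge> 2" by (simp add: S_eq distinct_card)
  have SV: "set ws \<subseteq> verts G"
    using S(2) subset_verts_contractD[of S G] by (auto simp: cycle_sets_def S_eq)
  have uvV: "u \<in> verts G" "v \<in> verts G" using edgeD[OF G uv] by auto
  have P: "{f \<in> edges G. f \<subseteq> set ws} = path_edges ws"
  proof -
    have "(`) Some ` {f \<in> edges G. f \<subseteq> set ws} = (`) Some ` path_edges ws"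
      using ys(4) edges_contract_within_Some[OF G S(1)] by (simp add: ws S_eq path_edges_map)
    then show ?thesis by (simp only: inj_image_eq_iff inj_image_Some)
  qed
  have N: "(nbrs G u \<inter> set ws) \<union> (nbrs G v \<inter> set ws) = {hd ws, last ws}"
  proof -
    have "Some ` ((nbrs G u \<union> nbrs G v - {u, v}) \<inter> set ws) = Some ` {hd ws, last ws}"
      using ys(5) d(3) nbrs_contract_None[OF G, of u v]
      by (simp add: ws hd_map last_map image_Int)
    then have "(nbrs G u \<union> nbrs G v - {u, v}) \<inter> set ws = {hd ws, last ws}"
      by (simp only: inj_image_eq_iff inj_Some)
    \<comment> \<open>Removing \<open>u\<close> and \<open>v\<close> has no effect here, since
      \<open>ws\<close> avoids both.\<close>
    then show ?thesis using S(1) S_eq by blast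
  qed
  have nin: "u \<notin> set ws" "v \<notin> set ws" using S(1) S_eq by auto
  note split = cycle_sets_split[OF G _ d(1,2) SV]
  consider "nbrs G u \<inter> set ws = {hd ws, last ws}" | "nbrs G v \<inter> set ws = {hd ws, last ws}"
    | "nbrs G u \<inter> set ws = {hd ws}" "nbrs G v \<inter> set ws = {last ws}"
    | "nbrs G u \<inter> set ws = {last ws}" "nbrs G v \<inter> set ws = {hd ws}"
    using Un_eq_doubleton[OF N] by auto
  then show "insert u S \<in> cycle_sets G \<or> insert v S \<in> cycle_sets G \<or>
      insert u (insert v S) \<in> cycle_sets G"
  proof cases
    case 1
    then have "insert u (set ws) \<in> cycle_sets G"
      by (intro cycle_setsI[OF G]) (use d SV uvV P nin in auto)
    then show ?thesis by (simp add: S_eq)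
  next
    case 2
    then have "insert v (set ws) \<in> cycle_sets G"
      by (intro cycle_setsI[OF G]) (use d SV uvV P nin in auto)
    then show ?thesis by (simp add: S_eq)
  next
    case 3
    then show ?thesis using split[OF uv nin P] by (simp add: S_eq)
  next
    case 4
    \<comment> \<open>The path meets \<open>u\<close> and \<open>v\<close> in the opposite order;
      exchanging their roles avoids reversing the list.\<close>
    then show ?thesis
      using split[of v u] uv nin P by (simp add: S_eq insert_commute)
  qed
qed

section \<open>Counting cycles, edges and vertices\<close>

lemma card_cycle_sets_contract:
  assumes G: "finite_simple_graph G" and uv: "{u, v} \<in> edges G"
  shows "card (cycle_sets (contract G {u, v})) + card (nbrs G u \<inter> nbrs G v) \<le> card (cycle_sets G)"
proof -
  let ?H = "contract G {u, v}"
  define T where "T = (\<lambda>w. {u, v, w}) ` (nbrs G u \<inter> nbrs G v)"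
  have ne: "w \<noteq> u \<and> w \<noteq> v" if "w \<in> nbrs G u \<inter> nbrs G v" for w
    using that edgeD(3)[OF G, of u w] edgeD(3)[OF G, of v w] by (auto simp: nbrs_def)
  have cardT: "card T = card (nbrs G u \<inter> nbrs G v)"
    unfolding T_def using ne by (intro card_image) (auto simp: inj_on_def)
  have T: "T \<subseteq> cycle_sets G"
    unfolding T_def using triangle_in_cycle_sets[OF G uv]
    by (auto simp: nbrs_def insert_commute)
  have small: "card (W - {u, v}) \<le> 1 \<and> u \<in> W \<and> v \<in> W" if W: "W \<in> T" for W
  proof -
    obtain w where "W = {u, v, w}" using W by (auto simp: T_def)
    moreover from this have "W - {u, v} \<subseteq> {w}" by auto
    then have "card (W - {u, v}) \<le> card {w}" by (intro card_mono) auto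
    ultimately show ?thesis by simp
  qed
  \<comment> \<open>Instead of choosing a lift for each cycle, one map on
    \<open>cycle_sets G - T\<close> is shown to cover all cycles of \<open>?H\<close>: it deletes
    \<open>u\<close> and \<open>v\<close>, and puts \<open>None\<close> in their place exactly when
    \<open>X\<close> meets \<open>{u, v}\<close>.\<close>
  have "\<exists>X \<in> cycle_sets G - T. W = (if X \<inter> {u, v} = {} then {} else {None}) \<union> Some ` (X - {u, v})"
    if W: "W \<in> cycle_sets ?H" for W
  proof -
    define S where "S = {x. Some x \<in> W}"
    have S: "S \<inter> {u, v} = {}"
      using W by (auto simp: S_def cycle_sets_def contract_def)
    have D: "S - {u, v} = S" "insert u S - {u, v} = S" "insert v S - {u, v} = S"
      "insert u (insert v S) - {u, v} = S"
      using S by auto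
    show ?thesis
    proof (cases "None \<in> W")
      case False
      then have eq: "W = Some ` S" unfolding S_def by (auto simp: image_iff) (metis option.exhaust)
      then have "S \<in> cycle_sets G" using cycle_sets_contract_avoiding[OF G S] W by simp
      \<comment> \<open>Every triangle in \<open>T\<close> contains \<open>u\<close>, while
        \<open>S\<close> does not.\<close>
      moreover have "S \<notin> T" using small S by blast
      ultimately show ?thesis using eq S D by (intro bexI[of _ S]) auto
    next
      case True
      then have eq: "W = insert None (Some ` S)"
        unfolding S_def by (auto simp: image_iff) (metis option.exhaust)
      note thr = cycle_sets_contract_through[OF G uv S W[unfolded eq]]
      from thr(2) obtain X where X: "X \<in> cycle_sets G" "X \<inter> {u, v} \<noteq> {}" "X - {u, v} = S"
        using D by blast
      \<comment> \<open>A triangle in \<open>T\<close> keeps at most one vertex outside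
        \<open>{u, v}\<close>, but \<open>X\<close> keeps all of \<open>S\<close>, hence at least
        two.\<close>
      then have "X \<notin> T" using small[of X] thr(1) by auto
      then show ?thesis using X eq by (intro bexI[of _ X]) auto
    qed
  qed
  then have "cycle_sets ?H \<subseteq> (\<lambda>X. (if X \<inter> {u, v} = {} then {} else {None}) \<union> Some ` (X - {u, v}))
      ` (cycle_sets G - T)"
    by blast
  then have "card (cycle_sets ?H) \<le> card (cycle_sets G - T)"
    by (rule surj_card_le[OF finite_Diff[OF finite_cycle_sets[OF G]]])
  also have "\<dots> = card (cycle_sets G) - card T"
    using T finite_cycle_sets[OF G] by (meson card_Diff_subset finite_subset)
  finally show ?thesis
    \<comment> \<open>The subtraction is on natural numbers, so \<open>card T\<close> must be known
      not to exceed \<open>card (cycle_sets G)\<close>.\<close>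
    using card_mono[OF finite_cycle_sets[OF G] T] cardT by linarith
qed

text \<open>The edges inside \<open>R\<close> survive. The edges from \<open>u\<close> and from
  \<open>v\<close> into \<open>R\<close> merge whenever they share their end in \<open>R\<close>,
  which costs one edge per common neighbour; the edge \<open>uv\<close> itself is also lost.\<close>

lemma card_edges_contract:
  assumes G: "finite_simple_graph G" and uv: "{u, v} \<in> edges G"
  shows "card (edges G) = card (edges (contract G {u, v})) + card (nbrs G u \<inter> nbrs G v) + 1"
proof -
  define R where "R = verts G - {u, v}"
  define A where "A = {f \<in> edges G. f \<subseteq> R}"
  define U where "U = nbrs G u \<inter> R"
  define V where "V = nbrs G v \<inter> R"
  have "finite (verts G)" using G by (simp add: finite_simple_graph_def)
  then have fin: "finite A" "finite U" "finite V"
    using finite_edges[OF G] by (auto simp: A_def U_def V_def R_def)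
  have ne: "u \<noteq> v" "u \<in> verts G" "v \<in> verts G" using edgeD[OF G uv] by auto
  have inj: "inj_on (\<lambda>w. {x, w}) B" for x :: 'b and B
    by (auto simp: inj_on_def doubleton_eq_iff)
  have "insert u (insert v R) = verts G" using ne by (auto simp: R_def)
  then have "edges G = {f \<in> edges G. f \<subseteq> insert u (insert v R)}"
    using G by (auto simp: finite_simple_graph_def)
  also have "\<dots> = A \<union> (\<lambda>w. {v, w}) ` V \<union> (\<lambda>w. {u, w}) ` (nbrs G u \<inter> insert v R)"
    unfolding edges_within_insert[OF G] A_def V_def ..
  \<comment> \<open>The edge \<open>uv\<close> is counted among the edges at \<open>u\<close>, so
    that the three families of edges are disjoint.\<close>
  also have "nbrs G u \<inter> insert v R = insert v U"
    using uv by (auto simp: U_def nbrs_def)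
  finally have E: "edges G = A \<union> (\<lambda>w. {v, w}) ` V \<union> (\<lambda>w. {u, w}) ` insert v U" .
  have "card (edges G) = card A + card V + card (insert v U)"
    unfolding E using ne fin
    by (subst card_Un_disjoint, simp, simp,
        fastforce simp: A_def U_def V_def R_def doubleton_eq_iff)+
      (simp add: card_image inj del: image_insert)
  also have "\<dots> = card A + (card U + card V) + 1"
    using fin by (simp add: U_def R_def)
  also have "card U + card V = card (U \<union> V) + card (U \<inter> V)"
    by (rule card_Un_Int[OF fin(2,3)])
  \<comment> \<open>Without loops a common neighbour is neither \<open>u\<close> nor
    \<open>v\<close>, so it lies in \<open>R\<close>.\<close>
  also have "U \<inter> V = nbrs G u \<inter> nbrs G v"
    using edgeD(2)[OF G] edgeD(3)[OF G, of u u] edgeD(3)[OF G, of v v]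
    by (auto simp: U_def V_def R_def nbrs_def)
  finally have 1: "card (edges G) = card A + card (U \<union> V) + card (nbrs G u \<inter> nbrs G v) + 1"
    by simp
  let ?H = "contract G {u, v}"
  have H: "finite_simple_graph ?H" using G by (rule finite_simple_graph_contract)
  have "verts ?H = insert None (Some ` R)" by (simp add: contract_def R_def)
  then have "edges ?H = {f \<in> edges ?H. f \<subseteq> insert None (Some ` R)}"
    using H by (auto simp: finite_simple_graph_def)
  also have "\<dots> = (`) Some ` A \<union> (\<lambda>w. {None, w}) ` (nbrs ?H None \<inter> Some ` R)"
    unfolding edges_within_insert[OF H] A_def
    by (subst edges_contract_within_Some[OF G]) (auto simp: R_def)
  also have "nbrs ?H None \<inter> Some ` R = Some ` (U \<union> V)"
    unfolding nbrs_contract_None[OF G] by (auto simp: U_def V_def R_def)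
  finally have E': "edges ?H = (`) Some ` A \<union> (\<lambda>w. {None, w}) ` Some ` (U \<union> V)" .
  have "card (edges ?H) = card ((`) Some ` A) + card ((\<lambda>w. {None, w}) ` Some ` (U \<union> V))"
    unfolding E' using fin by (intro card_Un_disjoint) auto
  also have "\<dots> = card A + card (U \<union> V)"
    by (simp add: card_image inj inj_on_subset[OF inj_image_Some])
  finally show ?thesis using 1 by simp
qed

lemma card_verts_contract:
  assumes "finite_simple_graph G" "{u, v} \<in> edges G"
  shows "card (verts G) = card (verts (contract G {u, v})) + 1"
proof -
  have uv: "u \<in> verts G" "v \<in> verts G" "u \<noteq> v" using edgeD[OF assms] by auto
  have fin: "finite (verts G)" using assms(1) by (simp add: finite_simple_graph_def)
  have "card (verts (contract G {u, v})) = Suc (card (verts G - {u, v}))"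
    using fin by (simp add: contract_def card_insert_if card_image)
  \<comment> \<open>Guarantees that subtracting 2 from the number of vertices does not truncate at
    0.\<close>
  moreover have "card {u, v} \<le> card (verts G)"
    using uv fin by (intro card_mono) auto
  ultimately show ?thesis using uv fin by (simp add: card_Diff_subset)
qed

theorem theorem3p1p1:
  fixes G :: "'a ugraph" and u v :: 'a and e :: "'a set"
  assumes "finite_simple_graph G"
    and "connected_graph G"
    and "e = {u, v}"
    and "e \<in> edges G"
  shows "beth2 (contract G e) \<le> beth2 G"
proof -
  have uv: "{u, v} \<in> edges G" using assms(3,4) by simp
  \<comment> \<open>The number of common neighbours cancels between cycles and edges, and the
    remaining 1 between edges and vertices.\<close>
  show ?thesis
    unfolding beth2_def card_induced_cycles assms(3)
    using card_cycle_sets_contract[OF assms(1) uv] card_edges_contract[OF assms(1) uv]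
      card_verts_contract[OF assms(1) uv]
    by linarith
qed

end
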